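(* Let $\mathcal{H}$ be a Hilbert space, let $F=\{f_i\}_{i\in\mathbb{I}}\subset\mathcal{H}$ be a sequence indexed by a countable set $\mathbb{I}$, and let $S_F$ be the corresponding operator $S_F:\mathcal{H}\to\mathcal{H}$, $S_F(f)=\sum_i\langle f,f_i\rangle f_i$. The following statements are equivalent: 1. $F$ is a frame for $\mathcal{H}$. 2. $S_F$ is well defined, bounded and there exist constants $A,B>0$ such that $A\le S_F\le B$. 3. $S_F$ is well defined, bounded and there exists $\alpha\in(0,\infty)$ such that $\|I-\alpha S_F\|<1$. 4. $S_F$ is well defined, bounded and invertible. 5. $S_F$ is well defined, bounded and surjective.
   Context: A family $F=\{f_i\}_{i\in\mathbb{I}}\subset\mathcal{H}$ is a frame for $\mathcal{H}$ if there are constants $A,B>0$ such that $A\|f\|^2\le\sum_i|\langle f,f_i\rangle|^2\le B\|f\|^2$ for every $f\in\mathcal{H}$. The operator $S_F$ is well defined if the series $\sum_i\langle f,f_i\rangle f_i$ converges in $\mathcal{H}$ for every $f\in\mathcal{H}$. Series over the countable set $\mathbb{I}$ are norm-convergent series with respect to a fixed enumeration of $\mathbb{I}$. For bounded operators $V,W$ on $\mathcal{H}$, $V\le W$ means $\langle V(f),f\rangle\le\langle W(f),f\rangle$ for every $f\in\mathcal{H}$; a scalar $A$ in such an inequality stands for $A\cdot I$, where $I$ is the identity operator on $\mathcal{H}$. Inner products are linear in the first variable. *)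

theory Defs
  imports "HOL-Analysis.Analysis"
begin

(* The scalar field of a Hilbert space.  The axioms force z to be a root of a real
   quadratic polynomial, so up to isomorphism the only instances are the reals (with
   trivial conjugation) and the complex numbers. *)
class real_or_complex = real_normed_field +
  fixes conjg :: "'a \<Rightarrow> 'a"
  assumes conjg_add: "conjg (x + y) = conjg x + conjg y"
    and conjg_mult: "conjg (x * y) = conjg x * conjg y"
    and conjg_conjg: "conjg (conjg x) = x"
    and mult_conjg: "x * conjg x = (norm x)\<^sup>2 *\<^sub>R 1"

instantiation real :: real_or_complex
begin
definition conjg_real :: "real \<Rightarrow> real" where "conjg_real x = x"
instance by standard (auto simp: conjg_real_def power2_eq_square)
end

instantiation complex :: real_or_complex
begin
definition conjg_complex :: "complex \<Rightarrow> complex" where "conjg_complex = cnj"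
instance
  by standard (auto simp: conjg_complex_def scaleR_conv_of_real
      complex_norm_square[symmetric] simp flip: of_real_power)
end

(* Completeness and the norm come from the type class banach; ip_self says that the norm
   is the one induced by the inner product. *)
locale hilbert_space = vector_space smul
  for smul :: "'k::real_or_complex \<Rightarrow> 'h::banach \<Rightarrow> 'h" +
  fixes ip :: "'h \<Rightarrow> 'h \<Rightarrow> 'k"
  assumes scale_of_real: "smul (of_real r) x = r *\<^sub>R x"
    and ip_add_left: "ip (x + y) z = ip x z + ip y z"
    and ip_scale_left: "ip (smul c x) y = c * ip x y"
    and ip_conjg: "ip y x = conjg (ip x y)"
    and ip_self: "ip x x = of_real ((norm x)\<^sup>2)"

lemma hilbert_space_real:
  "hilbert_space scaleR (inner :: 'h::{real_inner, banach} \<Rightarrow> 'h \<Rightarrow> real)"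
  by unfold_locales
    (auto simp: conjg_real_def inner_commute inner_add_left inner_add_right power2_norm_eq_inner
      scaleR_add_right scaleR_add_left)

lemma hilbert_space_complex:
  "hilbert_space ((*) :: complex \<Rightarrow> complex \<Rightarrow> complex) (\<lambda>x y. x * cnj y)"
  by unfold_locales
    (auto simp: conjg_complex_def algebra_simps scaleR_conv_of_real
      complex_norm_square[symmetric] simp flip: of_real_power)

(* An enumeration of the countable set I is a bijection onto I from this set. *)
definition enum_dom :: "'i set \<Rightarrow> nat set" where
  "enum_dom I = (if finite I then {..<card I} else UNIV)"

(* The series of g over I in the order given by the enumeration e; it is padded with
   zeros, so that for finite I it is the finite sum. *)
definition series_terms ::
    "(nat \<Rightarrow> 'i) \<Rightarrow> 'i set \<Rightarrow> ('i \<Rightarrow> 'v::real_normed_vector) \<Rightarrow> nat \<Rightarrow> 'v" where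
  "series_terms e I g = (\<lambda>k. if k \<in> enum_dom I then g (e k) else 0)"

(* An infinite value of the middle sum is excluded by the upper bound, hence summability. *)
definition is_frame ::
    "('h::real_normed_vector \<Rightarrow> 'h \<Rightarrow> 'k::real_or_complex) \<Rightarrow>
     (nat \<Rightarrow> 'i) \<Rightarrow> 'i set \<Rightarrow> ('i \<Rightarrow> 'h) \<Rightarrow> bool" where
  "is_frame ip e I F \<longleftrightarrow>
    (\<exists>A B :: real. A > 0 \<and> B > 0 \<and>
      (\<forall>f. summable (series_terms e I (\<lambda>i. (norm (ip f (F i)))\<^sup>2)) \<and>
           A * (norm f)\<^sup>2 \<le> suminf (series_terms e I (\<lambda>i. (norm (ip f (F i)))\<^sup>2)) \<and>
           suminf (series_terms e I (\<lambda>i. (norm (ip f (F i)))\<^sup>2)) \<le> B * (norm f)\<^sup>2))"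

definition frame_op ::
    "('k::real_or_complex \<Rightarrow> 'h::real_normed_vector \<Rightarrow> 'h) \<Rightarrow> ('h \<Rightarrow> 'h \<Rightarrow> 'k) \<Rightarrow>
     (nat \<Rightarrow> 'i) \<Rightarrow> 'i set \<Rightarrow> ('i \<Rightarrow> 'h) \<Rightarrow> 'h \<Rightarrow> 'h" where
  "frame_op smul ip e I F f = suminf (series_terms e I (\<lambda>i. smul (ip f (F i)) (F i)))"

definition frame_op_well_defined ::
    "('k::real_or_complex \<Rightarrow> 'h::real_normed_vector \<Rightarrow> 'h) \<Rightarrow> ('h \<Rightarrow> 'h \<Rightarrow> 'k) \<Rightarrow>
     (nat \<Rightarrow> 'i) \<Rightarrow> 'i set \<Rightarrow> ('i \<Rightarrow> 'h) \<Rightarrow> bool" where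
  "frame_op_well_defined smul ip e I F \<longleftrightarrow>
    (\<forall>f. summable (series_terms e I (\<lambda>i. smul (ip f (F i)) (F i))))"

(* bounded_linear only expresses linearity over the reals. *)
definition bounded_op ::
    "('k \<Rightarrow> 'h::real_normed_vector \<Rightarrow> 'h) \<Rightarrow> ('h \<Rightarrow> 'h) \<Rightarrow> bool" where
  "bounded_op smul T \<longleftrightarrow> bounded_linear T \<and> (\<forall>c x. T (smul c x) = smul c (T x))"

definition invertible_op ::
    "('k \<Rightarrow> 'h::real_normed_vector \<Rightarrow> 'h) \<Rightarrow> ('h \<Rightarrow> 'h) \<Rightarrow> bool" where
  "invertible_op smul T \<longleftrightarrow> (\<exists>U. bounded_op smul U \<and> T \<circ> U = id \<and> U \<circ> T = id)"

(* An inequality between scalars means that the difference is real and nonnegative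
   (for complex numbers this is the order of HOL-Library.Complex_Order). *)
definition op_le ::
    "('h \<Rightarrow> 'h \<Rightarrow> 'k::real_or_complex) \<Rightarrow> ('h \<Rightarrow> 'h) \<Rightarrow> ('h \<Rightarrow> 'h) \<Rightarrow> bool" where
  "op_le ip V W \<longleftrightarrow> (\<forall>f. \<exists>r::real. r \<ge> 0 \<and> ip (W f) f - ip (V f) f = of_real r)"

end

theory Submission
  imports Defs
begin

text \<open>
  Since \<open>\<langle>S f, f\<rangle> = \<Sum>i. |\<langle>f, f\<^sub>i\<rangle>|\<^sup>2\<close>, the frame inequalities are the operator inequalities
  \<open>A \<le> S \<le> B\<close>, and the Cauchy-Schwarz inequality turns the upper one into
  \<open>\<parallel>S f\<parallel>\<^sup>2 \<le> B \<langle>S f, f\<rangle>\<close>, which gives convergence and boundedness.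
  Expanding the square, \<open>\<parallel>f - S f / B\<parallel>\<^sup>2 \<le> \<parallel>f\<parallel>\<^sup>2 - \<langle>S f, f\<rangle> / B \<le> (1 - A / B) \<parallel>f\<parallel>\<^sup>2\<close>,
  and if \<open>I - \<alpha> S\<close> is a contraction then \<open>S\<close> is bijective by the fixed point theorem.
  Finally, let \<open>S\<close> be surjective and let \<open>W\<close> be the set of all \<open>f\<close> with \<open>\<parallel>S f\<parallel> \<le> 1\<close>. As
  \<open>|\<langle>f, S x\<rangle>| = |\<langle>S f, x\<rangle>| \<le> \<parallel>x\<parallel>\<close> on \<open>W\<close>, this set is weakly bounded, hence bounded, say by \<open>r\<close>;
  so \<open>\<parallel>f\<parallel>\<^sup>2 \<le> r\<^sup>2 \<parallel>S f\<parallel>\<^sup>2 \<le> r\<^sup>2 B \<langle>S f, f\<rangle>\<close>, a lower frame bound.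
\<close>

section \<open>Conjugation and norm on the scalar field\<close>

lemma norm_conjg [simp]: "norm (conjg x) = norm (x :: 'a::real_or_complex)"
proof (cases "x = 0")
  case True
  have "norm (conjg (0::'a)) = 0"
    by (metis add_cancel_right_right conjg_add norm_zero)
  then show ?thesis using True by simp
next
  case False
  have "norm x * norm (conjg x) = norm ((norm x)\<^sup>2 *\<^sub>R (1::'a))"
    by (metis mult_conjg norm_mult)
  then show ?thesis using False by (simp add: power2_eq_square)
qed

lemma conjg_of_real [simp]: "conjg (of_real r :: 'a::real_or_complex) = of_real r"
proof (cases "r = 0")
  case True
  then show ?thesis by (metis norm_conjg norm_eq_zero of_real_0)
next
  case False
  have "of_real r * conjg (of_real r :: 'a) = of_real r * of_real r"
    by (simp add: mult_conjg scaleR_conv_of_real power2_eq_square flip: of_real_mult)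
  then show ?thesis using False by (metis mult_left_cancel of_real_eq_0_iff)
qed

lemma mult_conjg_eq_of_real: "x * conjg x = of_real ((norm x)\<^sup>2)"
  by (simp add: mult_conjg scaleR_conv_of_real)

lemma bounded_op_imp_bounded_linear: "bounded_op smul T \<Longrightarrow> bounded_linear T"
  by (simp add: bounded_op_def)

context hilbert_space
begin

section \<open>Inner product, norm and the Cauchy-Schwarz inequality\<close>

lemma ip_scaleR_left: "ip (r *\<^sub>R x) y = of_real r * ip x y"
  by (metis ip_scale_left scale_of_real)

lemma ip_add_right: "ip x (y + z) = ip x y + ip x z"
  by (metis conjg_add ip_add_left ip_conjg)

lemma ip_scale_right: "ip x (smul c y) = conjg c * ip x y"
  by (metis conjg_mult ip_scale_left ip_conjg)

lemma ip_scaleR_right: "ip x (r *\<^sub>R y) = of_real r * ip x y"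
  by (metis conjg_of_real ip_scale_right scale_of_real)

lemma ip_diff_left: "ip (x - y) z = ip x z - ip y z"
  by (metis add_diff_cancel diff_add_cancel ip_add_left)

lemma ip_diff_right: "ip x (y - z) = ip x y - ip x z"
  by (metis add_diff_cancel diff_add_cancel ip_add_right)

lemma ip_zero_left [simp]: "ip 0 y = 0"
  by (metis diff_self ip_diff_left)

lemma norm_ip_commute: "norm (ip x y) = norm (ip y x)"
  by (metis ip_conjg norm_conjg)

lemma norm_smul: "norm (smul c x) = norm c * norm x"
proof -
  have "ip (smul c x) (smul c x) = (c * conjg c) * ip x x"
    by (simp add: ip_scale_left ip_scale_right mult.assoc)
  then have "of_real ((norm (smul c x))\<^sup>2) = (of_real ((norm c * norm x)\<^sup>2) :: 'k)"
    by (simp add: ip_self mult_conjg_eq_of_real power_mult_distrib)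
  then have "(norm (smul c x))\<^sup>2 = (norm c * norm x)\<^sup>2"
    by (simp only: of_real_eq_iff)
  then show ?thesis
    by (metis mult_nonneg_nonneg norm_ge_zero power2_eq_imp_eq)
qed

text \<open>A real inner product makes both cross terms equal to \<open>of_real r\<close>, so no
  real part is needed on the abstract scalar field.\<close>

lemma norm_diff_sq:
  assumes "ip x y = of_real r"
  shows "(norm (x - y))\<^sup>2 = (norm x)\<^sup>2 - 2 * r + (norm y)\<^sup>2"
proof -
  have "ip y x = of_real r"
    by (metis assms conjg_of_real ip_conjg)
  then have "ip (x - y) (x - y) = of_real ((norm x)\<^sup>2 - 2 * r + (norm y)\<^sup>2)"
    using assms by (simp add: ip_diff_left ip_diff_right ip_self[of x] ip_self[of y])
  then show ?thesis
    by (simp only: ip_self of_real_eq_iff)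
qed

lemma norm_ip_le: "norm (ip x y) \<le> norm x * norm y"
proof (cases "y = 0")
  case True
  then show ?thesis by (metis ip_zero_left mult_zero_right norm_ip_commute norm_zero order_refl)
next
  case False
  define z where "z = ip x y"
  \<comment> \<open>The difference of these two vectors is \<open>(norm y)\<^sup>2\<close> times the
    component of \<open>x\<close> orthogonal to \<open>y\<close>, which avoids a division. The
    factor \<open>z\<close> makes their inner product real, so that \<open>norm_diff_sq\<close>
    applies.\<close>
  have "ip ((norm y)\<^sup>2 *\<^sub>R x) (smul z y) = of_real ((norm y)\<^sup>2 * (norm z)\<^sup>2)"
    by (simp add: ip_scaleR_left ip_scale_right z_def mult_conjg_eq_of_real mult.commute)
  then have "(norm ((norm y)\<^sup>2 *\<^sub>R x - smul z y))\<^sup>2 =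
      (norm y)\<^sup>2 * ((norm x * norm y)\<^sup>2 - (norm z)\<^sup>2)"
    by (subst norm_diff_sq) (auto simp: norm_smul power2_eq_square algebra_simps)
  then have "0 \<le> (norm y)\<^sup>2 * ((norm x * norm y)\<^sup>2 - (norm z)\<^sup>2)"
    by (metis zero_le_power2)
  then have "(norm z)\<^sup>2 \<le> (norm x * norm y)\<^sup>2"
    using False by (simp add: zero_le_mult_iff)
  then show ?thesis
    by (metis mult_nonneg_nonneg norm_ge_zero power2_le_imp_le z_def)
qed

lemma bounded_linear_ip_left: "bounded_linear (\<lambda>x. ip x y)"
  by (rule bounded_linear_intro[where K = "norm y"])
    (auto simp: ip_add_left ip_scaleR_left scaleR_conv_of_real norm_ip_le)

lemma bounded_linear_ip_right: "bounded_linear (\<lambda>y. ip x y)"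
  by (rule bounded_linear_intro[where K = "norm x"])
    (auto simp: ip_add_right ip_scaleR_right scaleR_conv_of_real norm_ip_le mult.commute
      intro: order_trans[OF norm_ip_le])

lemma smul_scaleR: "smul c (r *\<^sub>R x) = r *\<^sub>R smul c x"
  by (simp add: mult.commute flip: scale_of_real)

lemma bounded_linear_smul: "bounded_linear (smul c)"
  by (rule bounded_linear_intro[where K = "norm c"])
    (auto simp: scale_right_distrib smul_scaleR norm_smul mult.commute)

section \<open>Uniform boundedness\<close>

text \<open>Uniform boundedness principle for the functionals \<open>\<lambda>y. ip y x\<close> with
  \<open>x\<close> in \<open>W\<close>: the closed sets on which all of them have norm at most
  \<open>n\<close> cover the complete space, so one of them contains a ball.\<close>

lemma weakly_bounded_imp_bounded:
  assumes "\<And>y. \<exists>b. \<forall>x\<in>W. norm (ip x y) \<le> b"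
  shows "\<exists>r. \<forall>x\<in>W. norm x \<le> r"
proof -
  define C where "C n = {y. \<forall>x\<in>W. norm (ip y x) \<le> real n}" for n
  have closed: "closed (C n)" for n
  proof -
    have "C n = (\<Inter>x\<in>W. {y. norm (ip y x) \<le> real n})"
      by (auto simp: C_def)
    moreover have "closed {y. norm (ip y x) \<le> real n}" for x
      by (intro closed_Collect_le continuous_intros
          linear_continuous_on[OF bounded_linear_ip_left])
    ultimately show ?thesis by auto
  qed
  have "\<exists>n. y \<in> C n" for y
  proof -
    obtain b where b: "\<forall>x\<in>W. norm (ip x y) \<le> b" using assms by blast
    obtain n where "b \<le> real n" using real_arch_simple by blast
    then have "y \<in> C n" using b by (auto simp: C_def norm_ip_commute[of y])
    then show ?thesis ..
  qed
  then have cover: "\<Union>(range C) = UNIV" by auto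
  \<comment> \<open>Otherwise the union of the sets \<open>C n\<close> would have empty interior by
    Baire's theorem, but it is the whole space.\<close>
  have "\<exists>n. interior (C n) \<noteq> {}"
  proof (rule ccontr)
    assume "\<not> ?thesis"
    then have "euclidean interior_of \<Union>(range C) = {}"
      using closed Met_TC.metric_Baire_category_alt[of "range C"]
      by (auto simp: complete_UNIV)
    then show False by (simp add: cover)
  qed
  then obtain n y d where d: "d > 0" "ball y d \<subseteq> C n"
    by (metis all_not_in_conv mem_interior)
  have "norm x \<le> 4 * real n / d" if "x \<in> W" for x
  proof (cases "x = 0")
    case True
    then show ?thesis using d by simp
  next
    case False
    \<comment> \<open>\<open>h\<close> points along \<open>x\<close> and has length
      \<open>d / 2\<close>, so \<open>y + h\<close> stays in the ball. Thus \<open>ip h x\<close> is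
      a difference of two scalars of norm at most \<open>n\<close>, while its norm is
      \<open>d / 2 * norm x\<close>.\<close>
    define h where "h = (d / (2 * norm x)) *\<^sub>R x"
    have "norm h = d / 2" using False d by (simp add: h_def)
    then have "y + h \<in> C n" "y \<in> C n" using d by (auto simp: dist_norm)
    then have "norm (ip (y + h) x) \<le> real n" "norm (ip y x) \<le> real n"
      using that by (auto simp: C_def)
    moreover have "ip h x = ip (y + h) x - ip y x" by (simp add: ip_add_left)
    ultimately have "norm (ip h x) \<le> 2 * real n"
      using norm_triangle_ineq4[of "ip (y + h) x" "ip y x"] by simp
    moreover have "norm (ip h x) = d / 2 * norm x"
      using False d
      by (simp add: h_def ip_scaleR_left ip_self norm_mult norm_divide power2_eq_square)
    ultimately show ?thesis using d by (simp add: field_simps)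
  qed
  then show ?thesis by blast
qed

section \<open>Bessel sequences and their frame operator\<close>

text \<open>The frame operator of a sequence over all naturals; a finite family fits this form after
  extension by zero vectors.\<close>

definition sop :: "(nat \<Rightarrow> 'h) \<Rightarrow> 'h \<Rightarrow> 'h" where
  "sop g f = (\<Sum>k. smul (ip f (g k)) (g k))"

text \<open>The upper frame inequality alone. Summability is demanded separately because
  \<open>suminf\<close> of a divergent series carries no information.\<close>

definition bessel :: "real \<Rightarrow> (nat \<Rightarrow> 'h) \<Rightarrow> bool" where
  "bessel B g \<longleftrightarrow> (\<forall>f. summable (\<lambda>k. (norm (ip f (g k)))\<^sup>2) \<and>
     (\<Sum>k. (norm (ip f (g k)))\<^sup>2) \<le> B * (norm f)\<^sup>2)"

lemma bessel_sum_le: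
  assumes "bessel B g" and "finite K"
  shows "(\<Sum>k\<in>K. (norm (ip f (g k)))\<^sup>2) \<le> B * (norm f)\<^sup>2"
proof -
  have "(\<Sum>k\<in>K. (norm (ip f (g k)))\<^sup>2) \<le> (\<Sum>k. (norm (ip f (g k)))\<^sup>2)"
    using assms by (intro sum_le_suminf) (auto simp: bessel_def)
  then show ?thesis using assms(1) unfolding bessel_def by (meson order_trans)
qed

text \<open>Expanding \<open>ip T T\<close> for the finite sum \<open>T\<close> pairs the
  coefficients of \<open>f\<close> with those of \<open>T\<close>, and Cauchy-Schwarz separates
  them.\<close>

lemma bessel_norm_sum_sq:
  assumes "bessel B g" and "B \<ge> 0" and "finite K"
  shows "(norm (\<Sum>k\<in>K. smul (ip f (g k)) (g k)))\<^sup>2 \<le> B * (\<Sum>k\<in>K. (norm (ip f (g k)))\<^sup>2)"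
proof -
  define T where "T = (\<Sum>k\<in>K. smul (ip f (g k)) (g k))"
  let ?s = "\<Sum>k\<in>K. (norm (ip f (g k)))\<^sup>2"
  have s: "?s \<ge> 0" by (simp add: sum_nonneg)
  have "ip T T = (\<Sum>k\<in>K. ip f (g k) * ip (g k) T)"
    using linear_sum[OF bounded_linear.linear[OF bounded_linear_ip_left[of T]],
        of "\<lambda>k. smul (ip f (g k)) (g k)" K]
    by (simp add: ip_scale_left flip: T_def)
  then have "norm (ip T T) \<le> (\<Sum>k\<in>K. norm (ip f (g k)) * norm (ip T (g k)))"
    by (metis (no_types, lifting) norm_ip_commute norm_mult norm_sum sum.cong)
  then have "((norm T)\<^sup>2)\<^sup>2 \<le> (\<Sum>k\<in>K. norm (ip f (g k)) * norm (ip T (g k)))\<^sup>2"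
    by (intro power_mono) (auto simp: ip_self norm_power)
  also have "\<dots> \<le> ?s * (\<Sum>k\<in>K. (norm (ip T (g k)))\<^sup>2)"
    by (rule Cauchy_Schwarz_ineq_sum)
  \<comment> \<open>The Bessel inequality is applied to \<open>T\<close> itself; the resulting
    \<open>(norm T)\<^sup>2\<close> cancels against the fourth power on the left.\<close>
  also have "\<dots> \<le> ?s * (B * (norm T)\<^sup>2)"
    using assms s by (intro mult_left_mono bessel_sum_le)
  finally have "(norm T)\<^sup>2 * (norm T)\<^sup>2 \<le> (B * ?s) * (norm T)\<^sup>2"
    by (simp add: power2_eq_square mult_ac)
  then show ?thesis
    unfolding T_def[symmetric]
    using s assms(2) by (cases "T = 0") (simp, metis mult_le_cancel_right_pos zero_less_norm_iff zero_less_power)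
qed

text \<open>Cauchy criterion: the squared norm of a block of the vector series is at most
  \<open>B\<close> times the same block of the convergent scalar series.\<close>

lemma bessel_summable:
  assumes "bessel B g" and "B \<ge> 0"
  shows "summable (\<lambda>k. smul (ip f (g k)) (g k))"
  unfolding summable_Cauchy
proof (intro allI impI)
  fix \<epsilon> :: real
  assume e: "\<epsilon> > 0"
  have "summable (\<lambda>k. B * (norm (ip f (g k)))\<^sup>2)"
    using assms by (intro summable_mult) (auto simp: bessel_def)
  then obtain N where N: "\<And>m n. m \<ge> N \<Longrightarrow> norm (\<Sum>k=m..<n. B * (norm (ip f (g k)))\<^sup>2) < \<epsilon>\<^sup>2"
    using e unfolding summable_Cauchy by (meson zero_less_power)
  have "norm (\<Sum>k=m..<n. smul (ip f (g k)) (g k)) < \<epsilon>" if "m \<ge> N" for m n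
  proof -
    have "(norm (\<Sum>k=m..<n. smul (ip f (g k)) (g k)))\<^sup>2 \<le> (\<Sum>k=m..<n. B * (norm (ip f (g k)))\<^sup>2)"
      using bessel_norm_sum_sq[OF assms, of "{m..<n}" f] by (simp add: sum_distrib_left)
    also have "\<dots> < \<epsilon>\<^sup>2" using N[OF that, of n] by simp
    finally show ?thesis using e by (auto intro: power2_less_imp_less)
  qed
  then show "\<exists>N. \<forall>m\<ge>N. \<forall>n. norm (\<Sum>k=m..<n. smul (ip f (g k)) (g k)) < \<epsilon>" by blast
qed

lemma sop_sums_ip_left:
  assumes "summable (\<lambda>k. smul (ip f (g k)) (g k))"
  shows "(\<lambda>k. ip f (g k) * ip (g k) h) sums ip (sop g f) h"
  using bounded_linear.sums[OF bounded_linear_ip_left summable_sums[OF assms]]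
  by (simp add: sop_def ip_scale_left)

lemma sop_sums_ip_right:
  assumes "summable (\<lambda>k. smul (ip h (g k)) (g k))"
  shows "(\<lambda>k. ip f (g k) * ip (g k) h) sums ip f (sop g h)"
  using bounded_linear.sums[OF bounded_linear_ip_right summable_sums[OF assms]]
  by (simp add: sop_def ip_scale_right mult.commute flip: ip_conjg)

text \<open>Both sides are the sum of the series with terms
  \<open>ip f (g k) * ip (g k) h\<close>.\<close>

lemma sop_selfadjoint:
  assumes "\<And>f. summable (\<lambda>k. smul (ip f (g k)) (g k))"
  shows "ip (sop g f) h = ip f (sop g h)"
  using sums_unique2[OF sop_sums_ip_left sop_sums_ip_right] assms by blast

lemma
  assumes "summable (\<lambda>k. smul (ip f (g k)) (g k))"
  shows summable_norm_ip_sq: "summable (\<lambda>k. (norm (ip f (g k)))\<^sup>2)"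
    and ip_sop_self: "ip (sop g f) f = of_real (\<Sum>k. (norm (ip f (g k)))\<^sup>2)"
proof -
  let ?s = "\<lambda>n. \<Sum>k<n. (norm (ip f (g k)))\<^sup>2"
  have "(\<lambda>k. of_real ((norm (ip f (g k)))\<^sup>2)) sums ip (sop g f) f"
    using sop_sums_ip_left[OF assms, of f]
    by (simp only: ip_conjg[of "g _" f] mult_conjg_eq_of_real)
  then have lim: "(\<lambda>n. of_real (?s n)) \<longlonglongrightarrow> ip (sop g f) f"
    unfolding sums_def by (simp only: of_real_sum)
  \<comment> \<open>The limit is real because the norm maps each partial sum to itself; completeness of the
    scalars is not available.\<close>
  have "norm (of_real (?s n) :: 'k) = ?s n" for n
    by (simp only: norm_of_real) (simp add: sum_nonneg)
  then have sums: "(\<lambda>k. (norm (ip f (g k)))\<^sup>2) sums norm (ip (sop g f) f)"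
    using tendsto_norm[OF lim] unfolding sums_def by simp
  then show "summable (\<lambda>k. (norm (ip f (g k)))\<^sup>2)" by (rule sums_summable)
  have "(\<lambda>n. of_real (?s n)) \<longlonglongrightarrow> (of_real (norm (ip (sop g f) f)) :: 'k)"
    using sums unfolding sums_def by (rule tendsto_of_real)
  then have "ip (sop g f) f = of_real (norm (ip (sop g f) f))"
    using lim LIMSEQ_unique by blast
  then show "ip (sop g f) f = of_real (\<Sum>k. (norm (ip f (g k)))\<^sup>2)"
    by (simp only: sums_unique[OF sums])
qed

text \<open>The limit of \<open>bessel_norm_sum_sq\<close>. The series is kept on the right, not
  replaced by its bound, because the contraction estimate and the lower frame bound both rest on
  this sharper form.\<close>

lemma bessel_norm_sop_sq:
  assumes "bessel B g" and "B \<ge> 0"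
  shows "(norm (sop g f))\<^sup>2 \<le> B * (\<Sum>k. (norm (ip f (g k)))\<^sup>2)"
proof (rule LIMSEQ_le)
  show "(\<lambda>n. (norm (\<Sum>k<n. smul (ip f (g k)) (g k)))\<^sup>2) \<longlonglongrightarrow> (norm (sop g f))\<^sup>2"
    using summable_LIMSEQ[OF bessel_summable[OF assms]] unfolding sop_def
    by (intro tendsto_intros)
  show "(\<lambda>n. B * (\<Sum>k<n. (norm (ip f (g k)))\<^sup>2)) \<longlonglongrightarrow> B * (\<Sum>k. (norm (ip f (g k)))\<^sup>2)"
    using assms(1) by (intro tendsto_intros summable_LIMSEQ) (auto simp: bessel_def)
qed (use bessel_norm_sum_sq[OF assms] in auto)

lemma bessel_bounded_op:
  assumes "bessel B g" and "B \<ge> 0"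
  shows "bounded_op smul (sop g)"
proof -
  note summable = bessel_summable[OF assms]
  have add: "sop g (x + y) = sop g x + sop g y" for x y
    unfolding sop_def
    by (simp add: suminf_add[OF summable summable] ip_add_left scale_left_distrib)
  have smul: "sop g (smul c x) = smul c (sop g x)" for c x
    unfolding sop_def
    by (simp add: bounded_linear.suminf[OF bounded_linear_smul summable] ip_scale_left)
  have "norm (sop g x) \<le> norm x * B" for x
  proof -
    have "(norm (sop g x))\<^sup>2 \<le> B * (\<Sum>k. (norm (ip x (g k)))\<^sup>2)"
      by (rule bessel_norm_sop_sq[OF assms])
    also have "\<dots> \<le> B * (B * (norm x)\<^sup>2)"
      using assms by (intro mult_left_mono) (auto simp: bessel_def)
    also have "\<dots> = (norm x * B)\<^sup>2"
      by (simp add: power2_eq_square mult_ac)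
    finally show ?thesis using assms(2) by (auto intro: power2_le_imp_le)
  qed
  then have "bounded_linear (sop g)"
    by (intro bounded_linear_intro[where K = B]) (auto simp: add smul simp flip: scale_of_real)
  then show ?thesis by (simp add: bounded_op_def smul)
qed

text \<open>The sum is \<open>ip (sop g f) f\<close>, so by Cauchy-Schwarz a positive operator bound
  is a Bessel bound.\<close>

lemma bounded_op_imp_bessel:
  assumes "\<And>f. summable (\<lambda>k. smul (ip f (g k)) (g k))" and "bounded_op smul (sop g)"
  shows "\<exists>B>0. bessel B g"
proof -
  obtain B where B: "B > 0" "\<And>x. norm (sop g x) \<le> norm x * B"
    using bounded_linear.pos_bounded[OF bounded_op_imp_bounded_linear[OF assms(2)]] by blast
  have "(\<Sum>k. (norm (ip f (g k)))\<^sup>2) \<le> B * (norm f)\<^sup>2" for f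
  proof -
    have "(\<Sum>k. (norm (ip f (g k)))\<^sup>2) \<le> norm (ip (sop g f) f)"
      by (simp only: ip_sop_self[OF assms(1)] norm_of_real)
    also have "\<dots> \<le> norm (sop g f) * norm f" by (rule norm_ip_le)
    also have "\<dots> \<le> (norm f * B) * norm f" by (intro mult_right_mono B) simp
    finally show ?thesis by (simp add: power2_eq_square mult_ac)
  qed
  then show ?thesis using B summable_norm_ip_sq[OF assms(1)] by (auto simp: bessel_def)
qed

section \<open>Contractions and invertibility\<close>

lemma onorm_id_minus_sop_less_1:
  assumes B: "bessel B g" and "B > 0" and "A > 0"
    and A: "\<And>f. A * (norm f)\<^sup>2 \<le> (\<Sum>k. (norm (ip f (g k)))\<^sup>2)"
  shows "onorm (\<lambda>f. f - (1 / B) *\<^sub>R sop g f) < 1"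
proof -
  \<comment> \<open>On the zero space the lower bound \<open>A\<close> may exceed \<open>B\<close>.\<close>
  define q where "q = max 0 (1 - A / B)"
  have "norm (f - (1 / B) *\<^sub>R sop g f) \<le> sqrt q * norm f" for f
  proof -
    let ?r = "\<Sum>k. (norm (ip f (g k)))\<^sup>2"
    have "ip f (sop g f) = of_real ?r"
      using ip_sop_self[OF bessel_summable[OF B], of f] \<open>B > 0\<close>
      by (simp only: ip_conjg[of f "sop g f"] conjg_of_real less_imp_le)
    then have "ip f ((1 / B) *\<^sub>R sop g f) = of_real (?r / B)"
      by (simp add: ip_scaleR_right)
    then have "(norm (f - (1 / B) *\<^sub>R sop g f))\<^sup>2 =
        (norm f)\<^sup>2 - 2 * (?r / B) + (norm (sop g f))\<^sup>2 / B\<^sup>2"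
      by (simp add: norm_diff_sq power_divide del: of_real_divide)
    \<comment> \<open>By \<open>bessel_norm_sop_sq\<close> the last term is at most
      \<open>?r / B\<close>, which uses up one of the two subtracted copies.\<close>
    also have "\<dots> \<le> (norm f)\<^sup>2 - ?r / B"
      using bessel_norm_sop_sq[OF B, of f] \<open>B > 0\<close> by (simp add: field_simps power2_eq_square)
    also have "\<dots> \<le> (1 - A / B) * (norm f)\<^sup>2"
      using A[of f] \<open>B > 0\<close> by (simp add: field_simps)
    also have "\<dots> \<le> q * (norm f)\<^sup>2"
      by (intro mult_right_mono) (auto simp: q_def)
    also have "\<dots> = (sqrt q * norm f)\<^sup>2"
      by (simp add: q_def power_mult_distrib)
    finally show ?thesis
      by (rule power2_le_imp_le) (simp add: q_def)
  qed
  then have "onorm (\<lambda>f. f - (1 / B) *\<^sub>R sop g f) \<le> sqrt q"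
    by (intro onorm_bound) (auto simp: q_def)
  also have "\<dots> < 1" using assms by (simp add: q_def)
  finally show ?thesis .
qed

text \<open>With R = I - \<alpha> T, the equation T x = y says that x is a fixed point of the
  contraction sending x to \<alpha> y + R x. The inverse is bounded because x = R x + \<alpha> T x
  bounds x by a multiple of T x in norm.\<close>

lemma invertible_op_if_onorm_less_1:
  assumes T: "bounded_op smul T" and "\<alpha> > 0" and less: "onorm (\<lambda>f. f - \<alpha> *\<^sub>R T f) < 1"
  shows "invertible_op smul T"
proof -
  interpret T: bounded_linear T by (rule bounded_op_imp_bounded_linear[OF T])
  define R where "R f = f - \<alpha> *\<^sub>R T f" for f
  define q where "q = onorm R"
  have R: "bounded_linear R"
    unfolding R_def
    by (intro bounded_linear_sub bounded_linear_ident bounded_linear_scaleR_right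
        bounded_linear_compose[OF bounded_linear_scaleR_right] T.bounded_linear_axioms)
  have q: "0 \<le> q" "q < 1"
    using less onorm_pos_le[OF R] by (auto simp: q_def R_def[abs_def])
  have Rq: "norm (R f) \<le> q * norm f" for f
    unfolding q_def by (rule onorm[OF R])
  have ex1: "\<exists>!x. T x = y" for y
  proof -
    have "dist (\<alpha> *\<^sub>R y + R x) (\<alpha> *\<^sub>R y + R x') \<le> q * dist x x'" for x x'
      using Rq[of "x - x'"] by (simp add: dist_norm linear_diff[OF bounded_linear.linear[OF R]])
    then have "\<exists>!x. \<alpha> *\<^sub>R y + R x = x"
      using q by (intro banach_fix_type) auto
    moreover have "\<alpha> *\<^sub>R y + R x = x \<longleftrightarrow> T x = y" for x
      using \<open>\<alpha> > 0\<close> by (auto simp: R_def algebra_simps)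
    ultimately show ?thesis by simp
  qed
  define U where "U y = (THE x. T x = y)" for y
  have TU: "T (U y) = y" for y
    unfolding U_def by (rule theI'[OF ex1])
  have UI: "U y = x" if "T x = y" for x y
    using that ex1 TU by blast
  have lower: "(1 - q) * norm x \<le> \<alpha> * norm (T x)" for x
  proof -
    have "norm x \<le> norm (R x) + norm (\<alpha> *\<^sub>R T x)"
      unfolding R_def by (metis diff_add_cancel norm_triangle_ineq)
    then show ?thesis using Rq[of x] \<open>\<alpha> > 0\<close> by (simp add: algebra_simps)
  qed
  have "bounded_linear U"
  proof (rule bounded_linear_intro[where K = "\<alpha> / (1 - q)"])
    show "norm (U y) \<le> norm y * (\<alpha> / (1 - q))" for y
      using lower[of "U y"] q by (simp add: TU field_simps)
  qed (auto intro!: UI simp: T.add T.scaleR TU)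
  moreover have "U (smul c y) = smul c (U y)" for c y
    using T by (intro UI) (simp add: bounded_op_def TU)
  ultimately have "bounded_op smul U" by (simp add: bounded_op_def)
  then show ?thesis
    unfolding invertible_op_def by (intro exI[of _ U]) (auto simp: TU UI)
qed

section \<open>Lower frame bound from surjectivity\<close>

lemma surj_sop_imp_lower_bound:
  assumes wd: "\<And>f. summable (\<lambda>k. smul (ip f (g k)) (g k))"
    and bd: "bounded_op smul (sop g)" and surj: "surj (sop g)"
  shows "\<exists>A>0. \<forall>f. A * (norm f)\<^sup>2 \<le> (\<Sum>k. (norm (ip f (g k)))\<^sup>2)"
proof -
  interpret S: bounded_linear "sop g" by (rule bounded_op_imp_bounded_linear[OF bd])
  obtain B where B: "B > 0" "bessel B g"
    using bounded_op_imp_bessel[OF wd bd] by blast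
  have "\<exists>b. \<forall>f\<in>{f. norm (sop g f) \<le> 1}. norm (ip f y) \<le> b" for y
  proof -
    obtain x where x: "y = sop g x" using surj by (metis surjD)
    have "norm (ip f y) \<le> norm x" if "norm (sop g f) \<le> 1" for f
    proof -
      have "norm (ip f y) \<le> norm (sop g f) * norm x"
        unfolding x sop_selfadjoint[OF wd, symmetric] by (rule norm_ip_le)
      also have "\<dots> \<le> norm x" using that by (intro mult_left_le_one_le) auto
      finally show ?thesis .
    qed
    then show ?thesis by blast
  qed
  then obtain r0 where r0: "\<And>f. norm (sop g f) \<le> 1 \<Longrightarrow> norm f \<le> r0"
    using weakly_bounded_imp_bounded[of "{f. norm (sop g f) \<le> 1}"] by blast
  \<comment> \<open>The maximum with 1 makes the radius positive, as \<open>r\<^sup>2 * B\<close>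
    becomes a denominator.\<close>
  define r where "r = max r0 1"
  have r: "r > 0" "\<And>f. norm (sop g f) \<le> 1 \<Longrightarrow> norm f \<le> r"
    using r0 by (auto simp: r_def le_max_iff_disj)
  \<comment> \<open>By self-adjointness the kernel is orthogonal to the range, which is the whole
    space. The kernel is treated first because the rescaling below divides by
    \<open>norm (sop g f)\<close>.\<close>
  have inj: "f = 0" if "sop g f = 0" for f
  proof -
    obtain x where "f = sop g x" using surj by (metis surjD)
    then have "ip f f = ip (sop g f) x"
      using sop_selfadjoint[OF wd] by simp
    then have "ip f f = 0" using that by simp
    then show ?thesis by (simp add: ip_self)
  qed
  have lower: "norm f \<le> r * norm (sop g f)" for f
  proof (cases "sop g f = 0")
    case True
    then show ?thesis using inj by simp
  next
    case False
    \<comment> \<open>After rescaling, the image has norm 1, so the vector lies in the bounded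
      set.\<close>
    then have "norm ((1 / norm (sop g f)) *\<^sub>R f) \<le> r"
      by (intro r(2)) (simp add: S.scaleR)
    then show ?thesis using False by (simp add: field_simps)
  qed
  have "1 / (r\<^sup>2 * B) * (norm f)\<^sup>2 \<le> (\<Sum>k. (norm (ip f (g k)))\<^sup>2)" for f
  proof -
    have "(norm f)\<^sup>2 \<le> (r * norm (sop g f))\<^sup>2"
      using lower by (intro power_mono) auto
    also have "\<dots> \<le> r\<^sup>2 * (B * (\<Sum>k. (norm (ip f (g k)))\<^sup>2))"
      using bessel_norm_sop_sq[OF B(2), of f] B by (simp add: power_mult_distrib mult_left_mono)
    finally show ?thesis using r B by (simp add: field_simps)
  qed
  then show ?thesis
    using r B by (intro exI[of _ "1 / (r\<^sup>2 * B)"]) auto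
qed

end

section \<open>Transfer to enumerated families and the equivalences\<close>

theorem theorem2p1:
  fixes smul :: "'k::real_or_complex \<Rightarrow> 'h::banach \<Rightarrow> 'h"
    and ip :: "'h \<Rightarrow> 'h \<Rightarrow> 'k"
    and I :: "'i set" and e :: "nat \<Rightarrow> 'i" and F :: "'i \<Rightarrow> 'h"
  assumes "hilbert_space smul ip"
    and "countable I" and "bij_betw e (enum_dom I) I"
  shows "(is_frame ip e I F \<longleftrightarrow>
            frame_op_well_defined smul ip e I F \<and>
            bounded_op smul (frame_op smul ip e I F) \<and>
            (\<exists>A B :: real. A > 0 \<and> B > 0 \<and>
               op_le ip (\<lambda>f. A *\<^sub>R f) (frame_op smul ip e I F) \<and>
               op_le ip (frame_op smul ip e I F) (\<lambda>f. B *\<^sub>R f)))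
       \<and> (is_frame ip e I F \<longleftrightarrow>
            frame_op_well_defined smul ip e I F \<and>
            bounded_op smul (frame_op smul ip e I F) \<and>
            (\<exists>\<alpha>::real. \<alpha> > 0 \<and> onorm (\<lambda>f. f - \<alpha> *\<^sub>R frame_op smul ip e I F f) < 1))
       \<and> (is_frame ip e I F \<longleftrightarrow>
            frame_op_well_defined smul ip e I F \<and>
            bounded_op smul (frame_op smul ip e I F) \<and>
            invertible_op smul (frame_op smul ip e I F))
       \<and> (is_frame ip e I F \<longleftrightarrow>
            frame_op_well_defined smul ip e I F \<and>
            bounded_op smul (frame_op smul ip e I F) \<and>
            surj (frame_op smul ip e I F))"
proof -
  interpret hilbert_space smul ip by fact
  \<comment> \<open>The vectors are padded with zeros instead of the terms; since the inner product
    with 0 vanishes, the series are the same.\<close>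
  define g where "g = series_terms e I F"
  have coeff: "series_terms e I (\<lambda>i. (norm (ip f (F i)))\<^sup>2) = (\<lambda>k. (norm (ip f (g k)))\<^sup>2)" for f
    using linear_0[OF bounded_linear.linear[OF bounded_linear_ip_right], of f]
    by (auto simp: g_def series_terms_def)
  have vec: "series_terms e I (\<lambda>i. smul (ip f (F i)) (F i)) = (\<lambda>k. smul (ip f (g k)) (g k))" for f
    by (auto simp: g_def series_terms_def)
  define S where "S = sop g"
  have S: "frame_op smul ip e I F = S"
    by (auto simp: S_def frame_op_def sop_def vec)
  define wd where "wd \<longleftrightarrow> (\<forall>f. summable (\<lambda>k. smul (ip f (g k)) (g k)))"
  have wd: "frame_op_well_defined smul ip e I F \<longleftrightarrow> wd"
    by (simp add: wd_def frame_op_well_defined_def vec)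
  have frame: "is_frame ip e I F \<longleftrightarrow> (\<exists>A B. A > 0 \<and> B > 0 \<and> bessel B g \<and>
      (\<forall>f. A * (norm f)\<^sup>2 \<le> (\<Sum>k. (norm (ip f (g k)))\<^sup>2)))"
    unfolding is_frame_def coeff bessel_def by meson
  have frame_wd: "wd \<and> bounded_op smul S" if "is_frame ip e I F"
    using that bessel_summable bessel_bounded_op unfolding frame wd_def S_def
    by (meson less_imp_le)
  have op_le_lower: "op_le ip (\<lambda>f. A *\<^sub>R f) S \<longleftrightarrow>
      (\<forall>f. A * (norm f)\<^sup>2 \<le> (\<Sum>k. (norm (ip f (g k)))\<^sup>2))" if wd for A
  proof -
    have "ip (S f) f - ip (A *\<^sub>R f) f =
        of_real ((\<Sum>k. (norm (ip f (g k)))\<^sup>2) - A * (norm f)\<^sup>2)" for f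
      using that ip_sop_self[of f g] by (simp add: S_def wd_def ip_scaleR_left ip_self)
    then show ?thesis by (simp only: op_le_def of_real_eq_iff) auto
  qed
  \<comment> \<open>The convergence contained in \<open>bessel\<close> comes from \<open>wd\<close>,
    so only the inequalities have to be compared.\<close>
  have op_le_upper: "op_le ip S (\<lambda>f. B *\<^sub>R f) \<longleftrightarrow> bessel B g" if wd for B
  proof -
    have "ip (B *\<^sub>R f) f - ip (S f) f =
        of_real (B * (norm f)\<^sup>2 - (\<Sum>k. (norm (ip f (g k)))\<^sup>2))" for f
      using that ip_sop_self[of f g] by (simp add: S_def wd_def ip_scaleR_left ip_self)
    moreover have "summable (\<lambda>k. (norm (ip f (g k)))\<^sup>2)" for f
      using that summable_norm_ip_sq by (simp add: wd_def)
    ultimately show ?thesis by (simp only: op_le_def bessel_def of_real_eq_iff) auto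
  qed
  \<comment> \<open>The operator inequalities are matched with the frame property directly; the
    other properties form the cycle frame, contraction, invertible, surjective, frame.\<close>
  have one_two: "is_frame ip e I F \<longleftrightarrow> wd \<and> bounded_op smul S \<and>
      (\<exists>A B. A > 0 \<and> B > 0 \<and> op_le ip (\<lambda>f. A *\<^sub>R f) S \<and> op_le ip S (\<lambda>f. B *\<^sub>R f))"
    using frame_wd op_le_lower op_le_upper unfolding frame by blast
  \<comment> \<open>The witness is 1 / B for a Bessel bound B.\<close>
  have one_three: "\<exists>\<alpha>>0. onorm (\<lambda>f. f - \<alpha> *\<^sub>R S f) < 1" if "is_frame ip e I F"
    using that onorm_id_minus_sop_less_1 unfolding frame S_def
    by (meson zero_less_divide_1_iff)
  have three_four: "invertible_op smul S"
    if "bounded_op smul S" "\<exists>\<alpha>>0. onorm (\<lambda>f. f - \<alpha> *\<^sub>R S f) < 1"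
    using that invertible_op_if_onorm_less_1 by blast
  have four_five: "surj S" if "invertible_op smul S"
    using that unfolding invertible_op_def by (metis comp_apply id_apply surjI)
  have five_one: "is_frame ip e I F" if "wd" "bounded_op smul S" "surj S"
    using that bounded_op_imp_bessel[of g] surj_sop_imp_lower_bound[of g]
    unfolding frame wd_def S_def by blast
  show ?thesis
    unfolding wd S
    using one_two frame_wd one_three three_four four_five five_one by blast
qed

end
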